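(* Let $A$ be a functionally continuous, saturated locally convex algebra whose spectrum $M(A)$ is equicontinuous. Then $A$ is a uniform normed algebra.
   Context: A topological algebra is an (associative, not necessarily commutative) algebra over $\mathbb{C}$ which is also a Hausdorff topological vector space such that the multiplication is separately continuous; a locally convex algebra is a topological algebra whose topology is locally convex. $M^*(A)$ denotes the set of all nonzero multiplicative linear functionals $A\to\mathbb{C}$, and $M(A)$ the subset of the continuous ones. $A$ is functionally continuous if $M^*(A)=M(A)$. A locally convex algebra $A$ with unit $e$ and $M^*(A)\neq\emptyset$ is saturated if its topology is determined by a family $\{p_s:s\in S\}$ of seminorms such that (a) $p_s(e)=1$ for all $s\in S$, and (b) for all $x\in A$ and $s\in S$ with $p_s(x)=1$, there exist $f_0,f\in M^*(A)$ such that $|f_0(x)|=\sup\{|f(y)|: y\in A,\ p_s(y)\le 1\}$. A uniform normed algebra is a normed algebra $(A,\|\cdot\|)$ (with submultiplicative norm, not necessarily complete) such that $\|x^2\|=\|x\|^2$ for all $x\in A$; saying that a topological algebra is a uniform normed algebra means that its topology is defined by such a norm. *)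

theory Defs
  imports "HOL-Analysis.Analysis"
begin

text \<open>
  Complex scalar multiplication is an explicit parameter \<open>scaleC\<close>, since the libraries have
  no class of complex algebras. The class \<open>ring\<close> is associative, with no unit and no
  commutativity required; the Hausdorff property comes from the class \<open>t2_space\<close>.
\<close>

locale complex_algebra = vector_space scaleC
  for scaleC :: "complex \<Rightarrow> 'a::ring \<Rightarrow> 'a" +
  assumes scale_mult_left: "scaleC c x * y = scaleC c (x * y)"
    and scale_mult_right: "x * scaleC c y = scaleC c (x * y)"

locale topological_algebra = complex_algebra scaleC
  for scaleC :: "complex \<Rightarrow> 'a::{ring, t2_space} \<Rightarrow> 'a" +
  assumes add_continuous: "continuous_on UNIV (\<lambda>(x, y). x + y :: 'a)"
    and scale_continuous: "continuous_on UNIV (\<lambda>(c, x). scaleC c x)"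
    and mult_left_continuous: "continuous_on UNIV (\<lambda>x::'a. a * x)"
    and mult_right_continuous: "continuous_on UNIV (\<lambda>x::'a. x * a)"

definition convex_wrt :: "(complex \<Rightarrow> 'a::ab_group_add \<Rightarrow> 'a) \<Rightarrow> 'a set \<Rightarrow> bool" where
  "convex_wrt scaleC V \<longleftrightarrow>
     (\<forall>x\<in>V. \<forall>y\<in>V. \<forall>u::real. \<forall>v::real. u \<ge> 0 \<longrightarrow> v \<ge> 0 \<longrightarrow> u + v = 1 \<longrightarrow>
        scaleC (of_real u) x + scaleC (of_real v) y \<in> V)"

locale locally_convex_algebra = topological_algebra scaleC
  for scaleC :: "complex \<Rightarrow> 'a::{ring, t2_space} \<Rightarrow> 'a" +
  assumes locally_convex:
    "open U \<Longrightarrow> 0 \<in> U \<Longrightarrow> \<exists>V. convex_wrt scaleC V \<and> 0 \<in> interior V \<and> V \<subseteq> U"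

definition mult_functionals :: "(complex \<Rightarrow> 'a::ring \<Rightarrow> 'a) \<Rightarrow> ('a \<Rightarrow> complex) set" where
  "mult_functionals scaleC =
     {f. Vector_Spaces.linear scaleC (*) f \<and> (\<forall>x y. f (x * y) = f x * f y) \<and> (\<exists>x. f x \<noteq> 0)}"

definition spectrum :: "(complex \<Rightarrow> 'a::{ring, topological_space} \<Rightarrow> 'a) \<Rightarrow> ('a \<Rightarrow> complex) set" where
  "spectrum scaleC = {f \<in> mult_functionals scaleC. continuous_on UNIV f}"

definition functionally_continuous ::
    "(complex \<Rightarrow> 'a::{ring, topological_space} \<Rightarrow> 'a) \<Rightarrow> bool" where
  "functionally_continuous scaleC \<longleftrightarrow> mult_functionals scaleC = spectrum scaleC"

definition equicontinuous :: "('a::topological_space \<Rightarrow> 'b::metric_space) set \<Rightarrow> bool" where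
  "equicontinuous F \<longleftrightarrow>
     (\<forall>x. \<forall>\<epsilon>>0. eventually (\<lambda>y. \<forall>f\<in>F. dist (f y) (f x) < \<epsilon>) (nhds x))"

definition seminorm :: "(complex \<Rightarrow> 'a::ab_group_add \<Rightarrow> 'a) \<Rightarrow> ('a \<Rightarrow> real) \<Rightarrow> bool" where
  "seminorm scaleC p \<longleftrightarrow>
     (\<forall>x. p x \<ge> 0) \<and> (\<forall>c x. p (scaleC c x) = cmod c * p x) \<and> (\<forall>x y. p (x + y) \<le> p x + p y)"

text \<open>
  The family need not be directed, so basic neighbourhoods are finite intersections of balls.
\<close>

definition topology_determined_by ::
    "('a::{ab_group_add, topological_space} \<Rightarrow> real) set \<Rightarrow> bool" where
  "topology_determined_by P \<longleftrightarrow>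
     (\<forall>U::'a set. open U \<longleftrightarrow>
        (\<forall>x\<in>U. \<exists>F \<epsilon>. finite F \<and> F \<subseteq> P \<and> \<epsilon> > 0 \<and> {y. \<forall>p\<in>F. p (y - x) < \<epsilon>} \<subseteq> U))"

text \<open>
  In condition (b) the functionals \<open>f0\<close> and \<open>f\<close> may differ. The supremum there equals a real
  number, hence is finite; \<open>bdd_above\<close> says so, as the real-valued \<open>SUP\<close> of an unbounded set
  is unspecified.
\<close>

locale saturated_algebra = locally_convex_algebra scaleC
  for scaleC :: "complex \<Rightarrow> 'a::{ring, t2_space} \<Rightarrow> 'a" +
  assumes mult_functionals_nonempty: "mult_functionals scaleC \<noteq> {}"
    and saturated:
      "\<exists>e. (\<forall>x. e * x = x \<and> x * e = x) \<and>
         (\<exists>P. (\<forall>p\<in>P. seminorm scaleC p) \<and> topology_determined_by P \<and>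
            (\<forall>p\<in>P. p e = 1) \<and>
            (\<forall>x. \<forall>p\<in>P. p x = 1 \<longrightarrow>
               (\<exists>f0\<in>mult_functionals scaleC. \<exists>f\<in>mult_functionals scaleC.
                  bdd_above ((\<lambda>y. cmod (f y)) ` {y. p y \<le> 1}) \<and>
                  cmod (f0 x) = (SUP y\<in>{y. p y \<le> 1}. cmod (f y)))))"

definition uniform_algebra_norm :: "(complex \<Rightarrow> 'a::ring \<Rightarrow> 'a) \<Rightarrow> ('a \<Rightarrow> real) \<Rightarrow> bool" where
  "uniform_algebra_norm scaleC N \<longleftrightarrow>
     seminorm scaleC N \<and> (\<forall>x. N x = 0 \<longrightarrow> x = 0) \<and>
     (\<forall>x y. N (x * y) \<le> N x * N y) \<and> (\<forall>x. N (x * x) = (N x)\<^sup>2)"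

definition uniform_normed_algebra ::
    "(complex \<Rightarrow> 'a::{ring, topological_space} \<Rightarrow> 'a) \<Rightarrow> bool" where
  "uniform_normed_algebra scaleC \<longleftrightarrow>
     complex_algebra scaleC \<and>
     (\<exists>N. uniform_algebra_norm scaleC N \<and> topology_determined_by {N})"

end

theory Submission
  imports Defs
begin

text \<open>
  The norm is the supremum of \<open>\<bar>f x\<bar>\<close> over the spectrum, finite and continuous by equicontinuity.
  Since \<open>p e = 1\<close> and \<open>f e = 1\<close>, the supremum in condition (b) is at least \<open>1\<close>, so (b) gives
  \<open>p x \<le> \<bar>f0 x\<bar>\<close> when \<open>p x = 1\<close>. After rescaling, every defining seminorm is dominated by this
  norm, which therefore separates points and defines the topology.
\<close>

text \<open>The sup norm of the Gelfand transform of \<open>x\<close>. A real \<open>SUP\<close> is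
  informative only for a nonempty bounded set; nonemptiness and equicontinuity of the spectrum
  supply this below.\<close>

definition spectral_seminorm ::
    "(complex \<Rightarrow> 'a::{ring, topological_space} \<Rightarrow> 'a) \<Rightarrow> 'a \<Rightarrow> real" where
  "spectral_seminorm scaleC x = (SUP f\<in>spectrum scaleC. cmod (f x))"

section \<open>Algebraic identities for multiplicative functionals\<close>

lemma mult_functionals_scale:
  "f \<in> mult_functionals scaleC \<Longrightarrow> f (scaleC c x) = c * f x"
  unfolding mult_functionals_def by (auto dest!: Vector_Spaces.linear.axioms(3) module_hom.scale)

lemma mult_functionals_add:
  "f \<in> mult_functionals scaleC \<Longrightarrow> f (x + y) = f x + f y"
  unfolding mult_functionals_def by (auto dest!: Vector_Spaces.linear.axioms(3) module_hom.add)

lemma mult_functionals_mult: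
  "f \<in> mult_functionals scaleC \<Longrightarrow> f (x * y) = f x * f y"
  unfolding mult_functionals_def by auto

lemma mult_functionals_zero:
  assumes "f \<in> mult_functionals scaleC"
  shows "f 0 = 0"
  using mult_functionals_add[OF assms, of 0 0] by simp

lemma mult_functionals_diff:
  assumes "f \<in> mult_functionals scaleC"
  shows "f (x - y) = f x - f y"
  using mult_functionals_add[OF assms, of "x - y" y] by simp

text \<open>Choose \<open>x\<close> with \<open>f x \<noteq> 0\<close> and cancel it in
  \<open>f x = f e * f x\<close>.\<close>

lemma mult_functionals_unit:
  assumes f: "f \<in> mult_functionals scaleC" and e: "\<And>x. e * x = x"
  shows "f e = 1"
proof -
  obtain x where "f x \<noteq> 0"
    using f unfolding mult_functionals_def by auto
  with mult_functionals_mult[OF f, of e x] e show ?thesis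
    by simp
qed

lemma spectrum_imp_mult_functional:
  "f \<in> spectrum scaleC \<Longrightarrow> f \<in> mult_functionals scaleC"
  unfolding spectrum_def by simp

text \<open>Both seminorms are homogeneous, so dividing \<open>x\<close> by \<open>p x\<close>
  reduces the claim to the unit sphere of \<open>p\<close>; if \<open>p x = 0\<close>, nonnegativity
  of \<open>N\<close> suffices. This carries condition (b), which speaks only of
  \<open>p x = 1\<close>, to all elements.\<close>

lemma seminorm_le_of_unit_sphere:
  assumes p: "seminorm scaleC p" and N: "seminorm scaleC N"
    and unit: "\<And>x. p x = 1 \<Longrightarrow> 1 \<le> N x"
  shows "p x \<le> N x"
proof (cases "p x = 0")
  case True
  with N show ?thesis
    unfolding seminorm_def by simp
next
  case False
  then have pos: "p x > 0"
    using p unfolding seminorm_def by (metis less_eq_real_def)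
  let ?c = "complex_of_real (inverse (p x))"
  have c: "cmod ?c = inverse (p x)"
    using pos by (simp only: norm_of_real) simp
  have scaled: "q (scaleC ?c x) = inverse (p x) * q x" if "seminorm scaleC q" for q
    using that c unfolding seminorm_def by presburger
  have "p (scaleC ?c x) = 1"
    using scaled[OF p] pos by simp
  then have "1 \<le> inverse (p x) * N x"
    using unit scaled[OF N] by metis
  then show ?thesis
    using pos by (simp add: field_simps)
qed

section \<open>Topologies determined by seminorms\<close>

lemma topology_determined_by_ball:
  assumes "topology_determined_by P" and "open U" and "x \<in> U"
  obtains F \<epsilon> where "F \<subseteq> P" "\<epsilon> > 0" "{y. \<forall>p\<in>F. p (y - x) < \<epsilon>} \<subseteq> U"
  using bspec[OF iffD1[OF spec[OF assms(1)[unfolded topology_determined_by_def]] assms(2)] assms(3)]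
  by (elim exE conjE)

text \<open>If all seminorms vanish at \<open>x\<close>, then \<open>x\<close> lies in every basic
  ball around \<open>0\<close>, so in a Hausdorff space it cannot be separated from
  \<open>0\<close>.\<close>

lemma topology_determined_by_separates:
  fixes x :: "'a::{ab_group_add, t2_space}"
  assumes P: "topology_determined_by P" and zero: "\<And>p. p \<in> P \<Longrightarrow> p x = 0"
  shows "x = 0"
proof (rule ccontr)
  assume "x \<noteq> 0"
  then obtain U where U: "open U" "0 \<in> U" "x \<notin> U"
    using hausdorff[of 0 x] by blast
  obtain F \<epsilon> where F: "F \<subseteq> P" "\<epsilon> > 0" "{y. \<forall>p\<in>F. p (y - 0) < \<epsilon>} \<subseteq> U"
    by (rule topology_determined_by_ball[OF P U(1,2)])
  have "\<forall>p\<in>F. p (x - 0) < \<epsilon>"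
  proof
    fix p assume "p \<in> F"
    with F(1) have "p x = 0"
      by (intro zero) blast
    with F(2) show "p (x - 0) < \<epsilon>"
      by simp
  qed
  with F(3) U(3) show False
    by blast
qed

section \<open>Pointwise bounds from equicontinuity\<close>

lemma (in topological_algebra) tendsto_scale_zero:
  "((\<lambda>c. scaleC c x) \<longlongrightarrow> 0) (at 0)"
proof -
  have "continuous_on UNIV (\<lambda>c. (\<lambda>(c, x). scaleC c x) (c, x))"
    by (rule continuous_on_compose2[OF scale_continuous]) (auto intro!: continuous_intros)
  then have "isCont (\<lambda>c. scaleC c x) 0"
    by (simp add: continuous_on_eq_continuous_at)
  then show ?thesis
    by (simp add: isCont_def)
qed

text \<open>Equicontinuity at \<open>0\<close> gives a neighbourhood of \<open>0\<close> on which
  every member of \<open>F\<close> has modulus below \<open>1\<close>. It contains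
  \<open>scaleC c x\<close> for some \<open>c \<noteq> 0\<close>, and linearity turns this into the
  common bound \<open>1 / cmod c\<close>.\<close>

lemma (in topological_algebra) equicontinuous_pointwise_bdd:
  assumes F: "F \<subseteq> mult_functionals scaleC" and equi: "equicontinuous F"
  shows "bdd_above ((\<lambda>f. cmod (f x)) ` F)"
proof -
  have "\<forall>\<^sub>F y in nhds 0. \<forall>f\<in>F. dist (f y) (f 0) < 1"
    using equi unfolding equicontinuous_def by simp
  then have "\<forall>\<^sub>F c in at 0. \<forall>f\<in>F. dist (f (scaleC c x)) (f 0) < 1"
    using tendsto_scale_zero unfolding filterlim_iff by blast
  \<comment> \<open>The bound divides by \<open>cmod c\<close>, so \<open>c\<close> is sought in the
    punctured filter, which is nontrivial and hence yields a witness.\<close>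
  moreover have "\<forall>\<^sub>F c in at (0::complex). c \<noteq> 0"
    by (simp add: eventually_at_filter)
  ultimately have "\<forall>\<^sub>F c in at 0. c \<noteq> 0 \<and> (\<forall>f\<in>F. dist (f (scaleC c x)) (f 0) < 1)"
    by eventually_elim simp
  then obtain c where c: "c \<noteq> 0" "\<And>f. f \<in> F \<Longrightarrow> dist (f (scaleC c x)) (f 0) < 1"
    using eventually_happens'[OF at_neq_bot] by blast
  have "cmod (f x) \<le> 1 / cmod c" if f: "f \<in> F" for f
  proof -
    have f': "f \<in> mult_functionals scaleC"
      using f F by blast
    have "cmod c * cmod (f x) < 1"
      using c(2)[OF f] mult_functionals_zero[OF f'] mult_functionals_scale[OF f', of c x]
      by (simp add: dist_norm norm_mult)
    with c(1) show ?thesis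
      by (simp add: field_simps)
  qed
  then show ?thesis
    by (rule bdd_aboveI2)
qed

section \<open>The spectral seminorm of an equicontinuous spectrum\<close>

context topological_algebra
begin

context
  assumes nonempty: "spectrum scaleC \<noteq> {}"
    and equi: "equicontinuous (spectrum scaleC)"
begin

lemma spectral_seminorm_upper:
  "f \<in> spectrum scaleC \<Longrightarrow> cmod (f x) \<le> spectral_seminorm scaleC x"
  unfolding spectral_seminorm_def
  by (rule cSUP_upper, assumption, rule equicontinuous_pointwise_bdd[OF _ equi])
    (auto intro: spectrum_imp_mult_functional)

lemma spectral_seminorm_least:
  "(\<And>f. f \<in> spectrum scaleC \<Longrightarrow> cmod (f x) \<le> B) \<Longrightarrow> spectral_seminorm scaleC x \<le> B"
  unfolding spectral_seminorm_def using nonempty by (rule cSUP_least)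

lemma spectral_seminorm_nonneg: "0 \<le> spectral_seminorm scaleC x"
  using nonempty spectral_seminorm_upper norm_ge_zero order_trans by blast

lemma spectral_seminorm_scale:
  "spectral_seminorm scaleC (scaleC c x) = cmod c * spectral_seminorm scaleC x"
proof -
  \<comment> \<open>Kept general in \<open>c\<close> and \<open>x\<close>: the reverse inequality is
    the same estimate for \<open>inverse c\<close> and \<open>scaleC c x\<close>.\<close>
  have le: "spectral_seminorm scaleC (scaleC c x) \<le> cmod c * spectral_seminorm scaleC x" for c x
    by (rule spectral_seminorm_least)
      (simp add: mult_functionals_scale[OF spectrum_imp_mult_functional] norm_mult
        spectral_seminorm_upper mult_left_mono)
  show ?thesis
  proof (cases "c = 0")
    case True
    with le[of c x] spectral_seminorm_nonneg[of "scaleC c x"] show ?thesis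
      by simp
  next
    case False
    then have "spectral_seminorm scaleC x \<le> cmod (inverse c) * spectral_seminorm scaleC (scaleC c x)"
      using le[of "inverse c" "scaleC c x"] by simp
    then have "cmod c * spectral_seminorm scaleC x \<le> spectral_seminorm scaleC (scaleC c x)"
      using False by (simp add: norm_divide field_simps)
    with le[of c x] show ?thesis
      by (rule antisym)
  qed
qed

lemma spectral_seminorm_triangle:
  "spectral_seminorm scaleC (x + y) \<le> spectral_seminorm scaleC x + spectral_seminorm scaleC y"
proof (rule spectral_seminorm_least)
  fix f assume f: "f \<in> spectrum scaleC"
  show "cmod (f (x + y)) \<le> spectral_seminorm scaleC x + spectral_seminorm scaleC y"
    unfolding mult_functionals_add[OF spectrum_imp_mult_functional[OF f]]
    using spectral_seminorm_upper[OF f] by (intro norm_triangle_mono)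
qed

lemma seminorm_spectral_seminorm: "seminorm scaleC (spectral_seminorm scaleC)"
  unfolding seminorm_def
  using spectral_seminorm_nonneg spectral_seminorm_scale spectral_seminorm_triangle by blast

lemma spectral_seminorm_mult:
  "spectral_seminorm scaleC (x * y) \<le> spectral_seminorm scaleC x * spectral_seminorm scaleC y"
  by (rule spectral_seminorm_least)
    (simp add: mult_functionals_mult[OF spectrum_imp_mult_functional] norm_mult
      mult_mono spectral_seminorm_upper spectral_seminorm_nonneg)

lemma spectral_seminorm_square:
  "spectral_seminorm scaleC (x * x) = (spectral_seminorm scaleC x)\<^sup>2"
proof (rule antisym)
  show "spectral_seminorm scaleC (x * x) \<le> (spectral_seminorm scaleC x)\<^sup>2"
    using spectral_seminorm_mult by (simp add: power2_eq_square)
  \<comment> \<open>Taking the root first allows the supremum to be bounded functional by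
    functional; squaring comes afterwards.\<close>
  have "spectral_seminorm scaleC x \<le> sqrt (spectral_seminorm scaleC (x * x))"
  proof (rule spectral_seminorm_least)
    fix f assume f: "f \<in> spectrum scaleC"
    have "(cmod (f x))\<^sup>2 = cmod (f (x * x))"
      using mult_functionals_mult[OF spectrum_imp_mult_functional[OF f]]
      by (simp add: norm_mult power2_eq_square)
    then show "cmod (f x) \<le> sqrt (spectral_seminorm scaleC (x * x))"
      using spectral_seminorm_upper[OF f] by (intro real_le_rsqrt) simp
  qed
  then show "(spectral_seminorm scaleC x)\<^sup>2 \<le> spectral_seminorm scaleC (x * x)"
    using spectral_seminorm_nonneg by (metis power_mono real_sqrt_pow2)
qed

lemma eventually_spectral_seminorm_less:
  assumes "\<epsilon> > 0"
  shows "\<forall>\<^sub>F y in nhds x. spectral_seminorm scaleC (y - x) < \<epsilon>"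
proof -
  \<comment> \<open>A strict bound on every \<open>f\<close> gives only a weak bound on the
    supremum, hence the half.\<close>
  have "\<forall>\<^sub>F y in nhds x. \<forall>f\<in>spectrum scaleC. dist (f y) (f x) < \<epsilon> / 2"
    using equi half_gt_zero[OF assms] unfolding equicontinuous_def by blast
  then show ?thesis
  proof eventually_elim
    case (elim y)
    have "spectral_seminorm scaleC (y - x) \<le> \<epsilon> / 2"
      by (rule spectral_seminorm_least)
        (use elim in \<open>force simp: mult_functionals_diff[OF spectrum_imp_mult_functional] dist_norm\<close>)
    with assms show ?case
      by simp
  qed
qed

text \<open>Domination of \<open>P\<close> puts a ball of the spectral seminorm inside each basic
  ball of \<open>P\<close>; equicontinuity makes its balls neighbourhoods in the given topology. So
  the two topologies agree.\<close>

lemma topology_determined_by_spectral_seminorm: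
  assumes P: "topology_determined_by P"
    and le: "\<And>p x. p \<in> P \<Longrightarrow> p x \<le> spectral_seminorm scaleC x"
  shows "topology_determined_by {spectral_seminorm scaleC}"
  unfolding topology_determined_by_def
proof (intro allI iffI)
  fix U :: "'a set"
  let ?N = "spectral_seminorm scaleC"
  show "\<forall>x\<in>U. \<exists>F \<epsilon>. finite F \<and> F \<subseteq> {?N} \<and> \<epsilon> > 0 \<and> {y. \<forall>p\<in>F. p (y - x) < \<epsilon>} \<subseteq> U"
    if U: "open U"
  proof
    fix x assume "x \<in> U"
    obtain F \<epsilon> where F: "F \<subseteq> P" "\<epsilon> > 0" "{y. \<forall>p\<in>F. p (y - x) < \<epsilon>} \<subseteq> U"
      by (rule topology_determined_by_ball[OF P U \<open>x \<in> U\<close>])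
    have "{y. \<forall>p\<in>{?N}. p (y - x) < \<epsilon>} \<subseteq> {y. \<forall>p\<in>F. p (y - x) < \<epsilon>}"
      using F(1) le by (blast intro: le_less_trans)
    with F show "\<exists>F \<epsilon>. finite F \<and> F \<subseteq> {?N} \<and> \<epsilon> > 0 \<and> {y. \<forall>p\<in>F. p (y - x) < \<epsilon>} \<subseteq> U"
      by (intro exI[of _ "{?N}"] exI[of _ \<epsilon>]) auto
  qed
  show "open U"
    if balls: "\<forall>x\<in>U. \<exists>F \<epsilon>. finite F \<and> F \<subseteq> {?N} \<and> \<epsilon> > 0 \<and> {y. \<forall>p\<in>F. p (y - x) < \<epsilon>} \<subseteq> U"
  proof (subst open_subopen, intro ballI)
    fix x assume "x \<in> U"
    with balls obtain F \<epsilon> where F: "F \<subseteq> {?N}" "\<epsilon> > 0" "{y. \<forall>p\<in>F. p (y - x) < \<epsilon>} \<subseteq> U"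
      by meson
    \<comment> \<open>\<open>F\<close> is empty or \<open>{?N}\<close>; in either case
      \<open>?N (y - x) < \<epsilon>\<close> places \<open>y\<close> in \<open>U\<close>.\<close>
    have "\<forall>\<^sub>F y in nhds x. y \<in> U"
      using eventually_spectral_seminorm_less[OF F(2)]
    proof eventually_elim
      case (elim y)
      with F(1,3) show ?case
        by blast
    qed
    then show "\<exists>T. open T \<and> x \<in> T \<and> T \<subseteq> U"
      unfolding eventually_nhds by blast
  qed
qed

end

end

theorem theorem2p5:
  fixes scaleC :: "complex \<Rightarrow> 'a::{ring, t2_space} \<Rightarrow> 'a"
  assumes "saturated_algebra scaleC"
    and "functionally_continuous scaleC"
    and "equicontinuous (spectrum scaleC)"
  shows "uniform_normed_algebra scaleC"
proof -
  interpret saturated_algebra scaleC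
    by fact
  let ?N = "spectral_seminorm scaleC"
  \<comment> \<open>This makes the spectrum nonempty and puts the functional \<open>f0\<close> of
    condition (b), not assumed continuous there, under the supremum.\<close>
  have M: "mult_functionals scaleC = spectrum scaleC"
    using assms(2) unfolding functionally_continuous_def .
  then have nonempty: "spectrum scaleC \<noteq> {}"
    using mult_functionals_nonempty by simp
  note hyps = nonempty assms(3)
  obtain e P where e: "\<forall>x. e * x = x \<and> x * e = x"
    and P: "\<forall>p\<in>P. seminorm scaleC p" "topology_determined_by P"
    and pe: "\<forall>p\<in>P. p e = 1"
    and sat: "\<forall>x. \<forall>p\<in>P. p x = 1 \<longrightarrow>
      (\<exists>f0\<in>mult_functionals scaleC. \<exists>f\<in>mult_functionals scaleC.
        bdd_above ((\<lambda>y. cmod (f y)) ` {y. p y \<le> 1}) \<and>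
        cmod (f0 x) = (SUP y\<in>{y. p y \<le> 1}. cmod (f y)))"
    using saturated by (elim exE conjE) (rule that)
  have unit: "1 \<le> ?N x" if p: "p \<in> P" and x: "p x = 1" for p x
  proof -
    obtain f0 f where f0: "f0 \<in> mult_functionals scaleC" and f: "f \<in> mult_functionals scaleC"
      and bdd: "bdd_above ((\<lambda>y. cmod (f y)) ` {y. p y \<le> 1})"
      and eq: "cmod (f0 x) = (SUP y\<in>{y. p y \<le> 1}. cmod (f y))"
      using mp[OF bspec[OF spec[OF sat] p] x] by (elim bexE conjE) (rule that)
    have "1 = cmod (f e)"
      using mult_functionals_unit[OF f] e by simp
    \<comment> \<open>The unit belongs to the closed unit ball of \<open>p\<close>, and
      \<open>bdd\<close> ensures that the supremum bounds its terms.\<close>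
    also have "\<dots> \<le> cmod (f0 x)"
      unfolding eq by (rule cSUP_upper[OF _ bdd]) (simp add: bspec[OF pe p])
    also have "\<dots> \<le> ?N x"
      using spectral_seminorm_upper[OF hyps] f0 M by blast
    finally show ?thesis .
  qed
  have le: "p x \<le> ?N x" if "p \<in> P" for p x
    using seminorm_le_of_unit_sphere[OF bspec[OF P(1) that] seminorm_spectral_seminorm[OF hyps]]
      unit[OF that] .
  \<comment> \<open>Each \<open>p x\<close> is squeezed between \<open>0\<close> and
    \<open>?N x\<close>, so the Hausdorff property applies.\<close>
  have definite: "x = 0" if "?N x = 0" for x
  proof (rule topology_determined_by_separates[OF P(2)])
    show "p x = 0" if "p \<in> P" for p
      using le[OF that, of x] bspec[OF P(1) that] \<open>?N x = 0\<close> unfolding seminorm_def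
      by (simp add: antisym)
  qed
  have "uniform_algebra_norm scaleC ?N"
    unfolding uniform_algebra_norm_def
    using seminorm_spectral_seminorm[OF hyps] definite spectral_seminorm_mult[OF hyps]
      spectral_seminorm_square[OF hyps] by blast
  moreover have "topology_determined_by {?N}"
    by (rule topology_determined_by_spectral_seminorm[OF hyps P(2)]) (rule le)
  ultimately show ?thesis
    unfolding uniform_normed_algebra_def using complex_algebra_axioms by blast
qed

end
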